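(* Let $F$ be a generic Riemannian submersion with totally umbilical fibers from a nearly Kaehler manifold $(M,g_M,J)$ onto a Riemannian manifold $(B,g_B)$. Then the mean curvature vector field $H^{\star}$ of the fibers satisfies $H^{\star}\in\Gamma(\omega\mathcal{D}^\perp)$.
   Context: An almost Hermitian manifold $(M,g_M,J)$ is a Riemannian manifold with an almost complex structure $J$ such that $J^2=-I$ and $g_M(JX,JY)=g_M(X,Y)$; $\nabla$ is the Levi-Civita connection of $g_M$. It is nearly Kaehler if $(\nabla_XJ)Y+(\nabla_YJ)X=0$ for all $X,Y$. A Riemannian submersion $F:(M,g_M)\to(B,g_B)$ (with $\dim M>\dim B$) is a smooth map of maximal rank whose differential $F_*$ preserves the scalar product of vectors normal to the fibers. $\ker F_*$ is the vertical distribution, its orthogonal complement $(\ker F_* )^\perp$ the horizontal distribution; $\mathcal{V},\mathcal{H}$ denote the orthogonal projections of $TM$ onto them. $F$ is a generic Riemannian submersion if there is a distribution $\mathcal{D}\subset\ker F_*$ with $\ker F_*=\mathcal{D}\oplus\mathcal{D}^\perp$ and $J\mathcal{D}=\mathcal{D}$, where $\mathcal{D}^\perp$ is the orthogonal complement of $\mathcal{D}$ in $\ker F_*$ and is purely real, i.e. $\mathcal{D}^\perp\cap J\mathcal{D}^\perp=\{0\}$. For vertical $U$ write $JU=\phi U+\omega U$ with $\phi U$ vertical and $\omega U$ horizontal. O'Neill's tensor: $\mathcal{T}_{E}G=\mathcal{H}\nabla_{\mathcal{V}E}\mathcal{V}G+\mathcal{V}\nabla_{\mathcal{V}E}\mathcal{H}G$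 for vector fields $E,G$ on $M$. $F$ has totally umbilical fibers if $\mathcal{T}_UV=g_M(U,V)H^{\star}$ for all $U,V\in\Gamma(\ker F_* )$, where $H^{\star}$ is the mean curvature vector field of the fibers (a horizontal vector field).
   Formalization: The distribution D is required to have positive rank; for D = 0 the claim fails, e.g. for the quotient of C² minus {x₁=x₂=0} by rotations of the (x₁,x₂)-plane, whose circle fibers are totally umbilical but H* is not in ωD^⊥. *)

theory Defs
  imports "HOL-Analysis.Analysis" "HOL-Library.Function_Algebras"
begin

instantiation "fun" :: (type, real_vector) real_vector
begin

definition "scaleR r f = (\<lambda>x. r *\<^sub>R f x)"

instance
  by standard (auto simp: scaleR_fun_def scaleR_add_right scaleR_add_left fun_eq_iff)

end

lemma scaleR_fun_apply [simp]: "(r *\<^sub>R f) x = r *\<^sub>R f x"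
  by (simp add: scaleR_fun_def)


section \<open>Smooth manifolds\<close>

text \<open>The two definitions below are used for open \<open>S\<close> only.  On a finite-dimensional domain,
  \<open>Ck_on k S f\<close> says that all iterated directional derivatives of \<open>f\<close> of order at most \<open>k\<close> exist
  and are continuous, i.e. that \<open>f\<close> is of class \<open>C^k\<close>.\<close>

primrec Ck_on :: "nat \<Rightarrow> 'e::real_normed_vector set \<Rightarrow> ('e \<Rightarrow> 'f::real_normed_vector) \<Rightarrow> bool" where
  "Ck_on 0 S f \<longleftrightarrow> continuous_on S f"
| "Ck_on (Suc k) S f \<longleftrightarrow>
     (\<forall>x\<in>S. f differentiable (at x)) \<and> (\<forall>v. Ck_on k S (\<lambda>x. frechet_derivative f (at x) v))"

definition smooth_on :: "'e::real_normed_vector set \<Rightarrow> ('e \<Rightarrow> 'f::real_normed_vector) \<Rightarrow> bool" where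
  "smooth_on S f \<longleftrightarrow> (\<forall>k. Ck_on k S f)"

text \<open>A manifold is a whole type of points with an atlas.  Charts are pairs of a domain and a map
  that is relevant on the domain only.  The model space is a finite-dimensional normed
  space (rather than a Euclidean space, whose dimension is positive in HOL) so that
  zero-dimensional manifolds are included.\<close>

type_synonym ('a, 'e) atlas = "('a set \<times> ('a \<Rightarrow> 'e)) set"

definition smooth_manifold ::
  "('a::{t2_space, second_countable_topology}, 'e::real_normed_vector) atlas \<Rightarrow> bool" where
  "smooth_manifold A \<longleftrightarrow>
     (\<exists>S::'e set. finite S \<and> span S = UNIV) \<and>
     (\<forall>(U, \<phi>)\<in>A. open U \<and> open (\<phi> ` U) \<and> homeomorphism U (\<phi> ` U) \<phi> (inv_into U \<phi>)) \<and>
     (\<Union>(U, \<phi>)\<in>A. U) = UNIV \<and>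
     (\<forall>(U, \<phi>)\<in>A. \<forall>(V, \<psi>)\<in>A. smooth_on (\<phi> ` (U \<inter> V)) (\<psi> \<circ> inv_into U \<phi>))"

definition smooth_fun_on :: "('a, 'e::real_normed_vector) atlas \<Rightarrow> 'a set \<Rightarrow> ('a \<Rightarrow> real) \<Rightarrow> bool" where
  "smooth_fun_on A W f \<longleftrightarrow> (\<forall>(U, \<phi>)\<in>A. smooth_on (\<phi> ` (U \<inter> W)) (f \<circ> inv_into U \<phi>))"

abbreviation smooth_funs :: "('a, 'e::real_normed_vector) atlas \<Rightarrow> ('a \<Rightarrow> real) set" where
  "smooth_funs A \<equiv> {f. smooth_fun_on A UNIV f}"

definition smooth_map ::
  "('a::topological_space, 'e::real_normed_vector) atlas \<Rightarrow>
   ('b::topological_space, 'f::real_normed_vector) atlas \<Rightarrow> ('a \<Rightarrow> 'b) \<Rightarrow> bool" where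
  "smooth_map A B F \<longleftrightarrow> continuous_on UNIV F \<and>
     (\<forall>(U, \<phi>)\<in>A. \<forall>(V, \<psi>)\<in>B. smooth_on (\<phi> ` (U \<inter> F -` V)) (\<psi> \<circ> F \<circ> inv_into U \<phi>))"

text \<open>A tangent vector is a directional derivative operator on smooth functions, i.e. a linear
  combination of the coordinate derivations of a chart; by convention it vanishes on functions
  that are not smooth.  The vector space operations are the pointwise ones.\<close>

type_synonym 'a tvec = "('a \<Rightarrow> real) \<Rightarrow> real"
type_synonym 'a vfield = "'a \<Rightarrow> 'a tvec"

definition tangent_space :: "('a, 'e::real_normed_vector) atlas \<Rightarrow> 'a \<Rightarrow> 'a tvec set" where
  "tangent_space A p = {v. \<exists>(U, \<phi>)\<in>A. p \<in> U \<and> (\<exists>w. v = (\<lambda>f.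
     if f \<in> smooth_funs A then frechet_derivative (f \<circ> inv_into U \<phi>) (at (\<phi> p)) w else 0))}"

definition differential ::
  "('b, 'f::real_normed_vector) atlas \<Rightarrow> ('a \<Rightarrow> 'b) \<Rightarrow> 'a tvec \<Rightarrow> 'b tvec" where
  "differential B F v = (\<lambda>h. if h \<in> smooth_funs B then v (h \<circ> F) else 0)"

definition smooth_vfield_on ::
  "('a, 'e::real_normed_vector) atlas \<Rightarrow> 'a set \<Rightarrow> 'a vfield \<Rightarrow> bool" where
  "smooth_vfield_on A W X \<longleftrightarrow> (\<forall>p\<in>W. X p \<in> tangent_space A p) \<and>
     (\<forall>f\<in>smooth_funs A. smooth_fun_on A W (\<lambda>p. X p f))"

abbreviation vfields :: "('a, 'e::real_normed_vector) atlas \<Rightarrow> 'a vfield set" where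
  "vfields A \<equiv> {X. smooth_vfield_on A UNIV X}"

definition sections :: "('a, 'e::real_normed_vector) atlas \<Rightarrow> ('a \<Rightarrow> 'a tvec set) \<Rightarrow> 'a vfield set" where
  "sections A S = {X \<in> vfields A. \<forall>p. X p \<in> S p}"

definition fmult :: "('a \<Rightarrow> real) \<Rightarrow> 'a vfield \<Rightarrow> 'a vfield" where
  "fmult f X = (\<lambda>p. f p *\<^sub>R X p)"

definition lie_bracket :: "'a vfield \<Rightarrow> 'a vfield \<Rightarrow> 'a vfield" where
  "lie_bracket X Y = (\<lambda>p f. X p (\<lambda>q. Y q f) - Y p (\<lambda>q. X q f))"

definition smooth_distribution ::
  "('a::topological_space, 'e::real_normed_vector) atlas \<Rightarrow> nat \<Rightarrow> ('a \<Rightarrow> 'a tvec set) \<Rightarrow> bool" where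
  "smooth_distribution A k D \<longleftrightarrow>
     (\<forall>p. \<exists>W. open W \<and> p \<in> W \<and> (\<exists>X::nat \<Rightarrow> 'a vfield.
        (\<forall>i<k. smooth_vfield_on A W (X i)) \<and>
        (\<forall>q\<in>W. inj_on (\<lambda>i. X i q) {..<k} \<and> independent ((\<lambda>i. X i q) ` {..<k}) \<and>
               D q = span ((\<lambda>i. X i q) ` {..<k}))))"


section \<open>Riemannian and almost Hermitian manifolds\<close>

type_synonym 'a metric_tensor = "'a \<Rightarrow> 'a tvec \<Rightarrow> 'a tvec \<Rightarrow> real"
type_synonym 'a connection = "'a vfield \<Rightarrow> 'a vfield \<Rightarrow> 'a vfield"
type_synonym 'a endo_field = "'a \<Rightarrow> 'a tvec \<Rightarrow> 'a tvec"

definition riemannian_metric :: "('a, 'e::real_normed_vector) atlas \<Rightarrow> 'a metric_tensor \<Rightarrow> bool" where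
  "riemannian_metric A g \<longleftrightarrow>
     (\<forall>p. \<forall>u\<in>tangent_space A p. \<forall>v\<in>tangent_space A p. \<forall>w\<in>tangent_space A p. \<forall>a b.
        g p (a *\<^sub>R u + b *\<^sub>R v) w = a * g p u w + b * g p v w) \<and>
     (\<forall>p. \<forall>u\<in>tangent_space A p. \<forall>v\<in>tangent_space A p. g p u v = g p v u) \<and>
     (\<forall>p. \<forall>u\<in>tangent_space A p. u \<noteq> 0 \<longrightarrow> g p u u > 0) \<and>
     (\<forall>X\<in>vfields A. \<forall>Y\<in>vfields A. (\<lambda>p. g p (X p) (Y p)) \<in> smooth_funs A)"

definition riemannian_manifold ::
  "('a::{t2_space, second_countable_topology}, 'e::real_normed_vector) atlas \<Rightarrow>
   'a metric_tensor \<Rightarrow> bool" where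
  "riemannian_manifold A g \<longleftrightarrow> smooth_manifold A \<and> riemannian_metric A g"

text \<open>Additivity of the connection in each argument, tensoriality in the first, the Leibniz rule in the second,
  compatibility with the metric and vanishing torsion.\<close>

definition levi_civita ::
  "('a, 'e::real_normed_vector) atlas \<Rightarrow> 'a metric_tensor \<Rightarrow> 'a connection \<Rightarrow> bool" where
  "levi_civita A g nab \<longleftrightarrow>
     (\<forall>X\<in>vfields A. \<forall>Y\<in>vfields A. nab X Y \<in> vfields A) \<and>
     (\<forall>X\<in>vfields A. \<forall>Y\<in>vfields A. \<forall>Z\<in>vfields A. nab (X + Y) Z = nab X Z + nab Y Z) \<and>
     (\<forall>X\<in>vfields A. \<forall>Y\<in>vfields A. \<forall>Z\<in>vfields A. nab X (Y + Z) = nab X Y + nab X Z) \<and>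
     (\<forall>f\<in>smooth_funs A. \<forall>X\<in>vfields A. \<forall>Y\<in>vfields A. nab (fmult f X) Y = fmult f (nab X Y)) \<and>
     (\<forall>f\<in>smooth_funs A. \<forall>X\<in>vfields A. \<forall>Y\<in>vfields A.
        nab X (fmult f Y) = fmult f (nab X Y) + fmult (\<lambda>p. X p f) Y) \<and>
     (\<forall>X\<in>vfields A. \<forall>Y\<in>vfields A. \<forall>Z\<in>vfields A. \<forall>p.
        X p (\<lambda>q. g q (Y q) (Z q)) = g p (nab X Y p) (Z p) + g p (Y p) (nab X Z p)) \<and>
     (\<forall>X\<in>vfields A. \<forall>Y\<in>vfields A. nab X Y - nab Y X = lie_bracket X Y)"

definition almost_complex_structure ::
  "('a, 'e::real_normed_vector) atlas \<Rightarrow> 'a endo_field \<Rightarrow> bool" where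
  "almost_complex_structure A J \<longleftrightarrow>
     (\<forall>p. \<forall>u\<in>tangent_space A p. J p u \<in> tangent_space A p) \<and>
     (\<forall>p. \<forall>u\<in>tangent_space A p. \<forall>v\<in>tangent_space A p. \<forall>a b.
        J p (a *\<^sub>R u + b *\<^sub>R v) = a *\<^sub>R J p u + b *\<^sub>R J p v) \<and>
     (\<forall>X\<in>vfields A. (\<lambda>p. J p (X p)) \<in> vfields A) \<and>
     (\<forall>p. \<forall>u\<in>tangent_space A p. J p (J p u) = - u)"

definition almost_hermitian_manifold ::
  "('a::{t2_space, second_countable_topology}, 'e::real_normed_vector) atlas \<Rightarrow>
   'a metric_tensor \<Rightarrow> 'a endo_field \<Rightarrow> bool" where
  "almost_hermitian_manifold A g J \<longleftrightarrow>
     riemannian_manifold A g \<and> almost_complex_structure A J \<and>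
     (\<forall>p. \<forall>u\<in>tangent_space A p. \<forall>v\<in>tangent_space A p. g p (J p u) (J p v) = g p u v)"

definition nabla_J :: "'a connection \<Rightarrow> 'a endo_field \<Rightarrow> 'a vfield \<Rightarrow> 'a vfield \<Rightarrow> 'a vfield" where
  "nabla_J nab J X Y = (\<lambda>p. nab X (\<lambda>q. J q (Y q)) p - J p (nab X Y p))"

definition nearly_kaehler_manifold ::
  "('a::{t2_space, second_countable_topology}, 'e::real_normed_vector) atlas \<Rightarrow>
   'a metric_tensor \<Rightarrow> 'a endo_field \<Rightarrow> 'a connection \<Rightarrow> bool" where
  "nearly_kaehler_manifold A g J nab \<longleftrightarrow>
     almost_hermitian_manifold A g J \<and> levi_civita A g nab \<and>
     (\<forall>X\<in>vfields A. \<forall>Y\<in>vfields A. nabla_J nab J X Y + nabla_J nab J Y X = 0)"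


section \<open>Riemannian submersions\<close>

definition orth_in :: "'a metric_tensor \<Rightarrow> 'a \<Rightarrow> 'a tvec set \<Rightarrow> 'a tvec set \<Rightarrow> 'a tvec set" where
  "orth_in g p T S = {v \<in> T. \<forall>u\<in>S. g p u v = 0}"

definition orth_proj :: "'a metric_tensor \<Rightarrow> 'a \<Rightarrow> 'a tvec set \<Rightarrow> 'a tvec \<Rightarrow> 'a tvec" where
  "orth_proj g p S v = (THE u. u \<in> S \<and> (\<forall>w\<in>S. g p w (v - u) = 0))"

definition vertical ::
  "('a, 'e::real_normed_vector) atlas \<Rightarrow> ('b, 'f::real_normed_vector) atlas \<Rightarrow> ('a \<Rightarrow> 'b) \<Rightarrow>
   'a \<Rightarrow> 'a tvec set" where
  "vertical A B F p = {v \<in> tangent_space A p. differential B F v = 0}"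

definition horizontal ::
  "('a, 'e::real_normed_vector) atlas \<Rightarrow> 'a metric_tensor \<Rightarrow> ('b, 'f::real_normed_vector) atlas \<Rightarrow>
   ('a \<Rightarrow> 'b) \<Rightarrow> 'a \<Rightarrow> 'a tvec set" where
  "horizontal A g B F p = orth_in g p (tangent_space A p) (vertical A B F p)"

definition ver_proj ::
  "('a, 'e::real_normed_vector) atlas \<Rightarrow> 'a metric_tensor \<Rightarrow> ('b, 'f::real_normed_vector) atlas \<Rightarrow>
   ('a \<Rightarrow> 'b) \<Rightarrow> 'a endo_field" where
  "ver_proj A g B F p = orth_proj g p (vertical A B F p)"

definition hor_proj ::
  "('a, 'e::real_normed_vector) atlas \<Rightarrow> 'a metric_tensor \<Rightarrow> ('b, 'f::real_normed_vector) atlas \<Rightarrow>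
   ('a \<Rightarrow> 'b) \<Rightarrow> 'a endo_field" where
  "hor_proj A g B F p = orth_proj g p (horizontal A g B F p)"

definition riemannian_submersion ::
  "('a::{t2_space, second_countable_topology}, 'e::real_normed_vector) atlas \<Rightarrow>
   'a metric_tensor \<Rightarrow>
   ('b::{t2_space, second_countable_topology}, 'f::real_normed_vector) atlas \<Rightarrow>
   'b metric_tensor \<Rightarrow> ('a \<Rightarrow> 'b) \<Rightarrow> bool" where
  "riemannian_submersion A g B gB F \<longleftrightarrow>
     riemannian_manifold A g \<and> riemannian_manifold B gB \<and>
     dim (UNIV :: 'f set) < dim (UNIV :: 'e set) \<and>
     smooth_map A B F \<and> surj F \<and>
     (\<forall>p. differential B F ` tangent_space A p = tangent_space B (F p)) \<and>
     (\<forall>p. \<forall>u\<in>horizontal A g B F p. \<forall>v\<in>horizontal A g B F p.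
        gB (F p) (differential B F u) (differential B F v) = g p u v)"

definition oneill_T ::
  "('a, 'e::real_normed_vector) atlas \<Rightarrow> 'a metric_tensor \<Rightarrow> 'a connection \<Rightarrow>
   ('b, 'f::real_normed_vector) atlas \<Rightarrow> ('a \<Rightarrow> 'b) \<Rightarrow> 'a vfield \<Rightarrow> 'a vfield \<Rightarrow> 'a vfield" where
  "oneill_T A g nab B F E G =
     (let \<V> = ver_proj A g B F; \<H> = hor_proj A g B F;
          VE = (\<lambda>p. \<V> p (E p)); VG = (\<lambda>p. \<V> p (G p)); HG = (\<lambda>p. \<H> p (G p))
      in (\<lambda>p. \<H> p (nab VE VG p) + \<V> p (nab VE HG p)))"

text \<open>The mean curvature vector field of the fibers is \<open>1/r\<close> times the trace of \<open>T\<close>, where \<open>r\<close> is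
  the dimension of the fibers.  Since \<open>T\<close> is tensorial, the trace at \<open>p\<close> is computed from
  any vertical fields that are orthonormal at the point \<open>p\<close>.\<close>

definition mean_curvature_field ::
  "('a, 'e::real_normed_vector) atlas \<Rightarrow> 'a metric_tensor \<Rightarrow> 'a connection \<Rightarrow>
   ('b, 'f::real_normed_vector) atlas \<Rightarrow> ('a \<Rightarrow> 'b) \<Rightarrow> 'a vfield \<Rightarrow> bool" where
  "mean_curvature_field A g nab B F H \<longleftrightarrow>
     H \<in> sections A (horizontal A g B F) \<and>
     (let r = dim (UNIV :: 'e set) - dim (UNIV :: 'f set) in
      \<forall>p. \<forall>U::nat \<Rightarrow> 'a vfield.
        (\<forall>i<r. U i \<in> sections A (vertical A B F)) \<and>
        (\<forall>i<r. \<forall>j<r. g p (U i p) (U j p) = (if i = j then 1 else 0)) \<longrightarrow>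
        H p = (1 / real r) *\<^sub>R (\<Sum>i<r. oneill_T A g nab B F (U i) (U i) p))"

definition totally_umbilical_fibers ::
  "('a, 'e::real_normed_vector) atlas \<Rightarrow> 'a metric_tensor \<Rightarrow> 'a connection \<Rightarrow>
   ('b, 'f::real_normed_vector) atlas \<Rightarrow> ('a \<Rightarrow> 'b) \<Rightarrow> 'a vfield \<Rightarrow> bool" where
  "totally_umbilical_fibers A g nab B F H \<longleftrightarrow>
     mean_curvature_field A g nab B F H \<and>
     (\<forall>U\<in>sections A (vertical A B F). \<forall>V\<in>sections A (vertical A B F).
        oneill_T A g nab B F U V = fmult (\<lambda>p. g p (U p) (V p)) H)"


section \<open>Generic Riemannian submersions\<close>

definition D_perp ::
  "('a, 'e::real_normed_vector) atlas \<Rightarrow> 'a metric_tensor \<Rightarrow> ('b, 'f::real_normed_vector) atlas \<Rightarrow>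
   ('a \<Rightarrow> 'b) \<Rightarrow> ('a \<Rightarrow> 'a tvec set) \<Rightarrow> 'a \<Rightarrow> 'a tvec set" where
  "D_perp A g B F D p = orth_in g p (vertical A B F p) (D p)"

text \<open>The distribution \<open>D\<close> has positive rank: for \<open>D = 0\<close> the fibers are only
  required to be purely real, and umbilicity then gives no control on the mean curvature (for
  instance when the fibers are curves, which are always totally umbilical).\<close>

definition generic_riemannian_submersion ::
  "('a::{t2_space, second_countable_topology}, 'e::real_normed_vector) atlas \<Rightarrow>
   'a metric_tensor \<Rightarrow> 'a endo_field \<Rightarrow>
   ('b::{t2_space, second_countable_topology}, 'f::real_normed_vector) atlas \<Rightarrow>
   'b metric_tensor \<Rightarrow> ('a \<Rightarrow> 'b) \<Rightarrow> ('a \<Rightarrow> 'a tvec set) \<Rightarrow> bool" where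
  "generic_riemannian_submersion A g J B gB F D \<longleftrightarrow>
     riemannian_submersion A g B gB F \<and>
     (\<exists>k\<ge>1. smooth_distribution A k D) \<and>
     (\<forall>p. D p \<subseteq> vertical A B F p) \<and>
     (\<forall>p. vertical A B F p = {u + v | u v. u \<in> D p \<and> v \<in> D_perp A g B F D p} \<and>
          D p \<inter> D_perp A g B F D p = {0}) \<and>
     (\<forall>p. J p ` D p = D p) \<and>
     (\<forall>p. D_perp A g B F D p \<inter> J p ` D_perp A g B F D p = {0})"

definition omega ::
  "('a, 'e::real_normed_vector) atlas \<Rightarrow> 'a metric_tensor \<Rightarrow> 'a endo_field \<Rightarrow>
   ('b, 'f::real_normed_vector) atlas \<Rightarrow> ('a \<Rightarrow> 'b) \<Rightarrow> 'a endo_field" where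
  "omega A g J B F p u = hor_proj A g B F p (J p u)"

end

theory Submission
  imports Defs "HOL-Real_Asymp.Real_Asymp"
begin

text \<open>Let \<open>X\<close> be a section of \<open>D\<close>.  Then \<open>X\<close> and \<open>JX\<close> are vertical, and \<open>(\<nabla>\<^sub>XJ)X = 0\<close> says
  \<open>\<nabla>\<^sub>XJX = J\<nabla>\<^sub>XX\<close>.  If \<open>Y\<close> and \<open>JY\<close> are both horizontal, umbilicity gives
  \<open>g(X,X) g(Y,H) = g(Y,\<nabla>\<^sub>XX) = g(JY,\<nabla>\<^sub>XJX) = g(X,JX) g(JY,H) = 0\<close>.  The component \<open>Y\<close> of \<open>H\<close> orthogonal to
  \<open>\<omega>D\<^sup>\<bottom>\<close> is of this kind, since \<open>JY\<close> is orthogonal to \<open>D\<close> (as \<open>JD = D\<close>) and to \<open>D\<^sup>\<bottom>\<close>; hence it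
  vanishes.  The connection only acts on global fields, so a section \<open>X\<close> with \<open>X p \<noteq> 0\<close> is
  produced from a local frame of \<open>D\<close> with a bump function.\<close>

section \<open>Calculus of \<open>C^k\<close> functions\<close>

text \<open>Openness of \<open>S\<close> carries the induction: functions that agree on an open set
  have the same Frechet derivative at each of its points, so the directional derivatives agree there
  as well.\<close>

lemma Ck_on_cong:
  assumes "open S" "\<And>x. x \<in> S \<Longrightarrow> f x = g x" "Ck_on k S f"
  shows "Ck_on k S g"
  using assms(2,3)
proof (induction k arbitrary: f g)
  case 0
  then show ?case by (simp cong: continuous_on_cong)
next
  case (Suc k)
  have d: "(g has_derivative frechet_derivative f (at x)) (at x)" if "x \<in> S" for x
    by (rule has_derivative_transform_within_open[OF _ assms(1) that Suc.prems(1)])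
      (use Suc.prems that in \<open>auto simp: frechet_derivative_works[symmetric]\<close>)
  have e: "frechet_derivative g (at x) = frechet_derivative f (at x)" if "x \<in> S" for x
    using frechet_derivative_at[OF d[OF that]] by simp
  have "Ck_on k S (\<lambda>x. frechet_derivative g (at x) v)" for v
    by (rule Suc.IH[of "\<lambda>x. frechet_derivative f (at x) v"]) (use Suc.prems e in auto)
  then show ?case
    using d by (auto simp: differentiable_def)
qed

text \<open>The successor clause of \<open>Ck_on\<close> does not demand continuity of the function
  itself; at the base case continuity comes from differentiability.\<close>

lemma Ck_on_SucD: "Ck_on (Suc k) S f \<Longrightarrow> Ck_on k S f"
proof (induction k arbitrary: f)
  case 0
  then show ?case
    by (auto intro: continuous_at_imp_continuous_on differentiable_imp_continuous_within)
next
  case (Suc k)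
  then show ?case by (metis Ck_on.simps(2))
qed

text \<open>Lets the closure proofs work with an explicit derivative from the usual differentiation
  rules; uniqueness of the derivative identifies it with \<open>frechet_derivative\<close>.\<close>

lemma Ck_on_SucI:
  assumes "open S" "\<And>x. x \<in> S \<Longrightarrow> (f has_derivative f' x) (at x)" "\<And>v. Ck_on k S (\<lambda>x. f' x v)"
  shows "Ck_on (Suc k) S f"
proof -
  have "Ck_on k S (\<lambda>x. frechet_derivative f (at x) v)" for v
    by (rule Ck_on_cong[OF assms(1) _ assms(3)[of v]]) (metis assms(2) frechet_derivative_at)
  then show ?thesis
    using assms(2) by (auto simp: differentiable_def)
qed

lemma Ck_on_has_derivative:
  "Ck_on (Suc k) S f \<Longrightarrow> x \<in> S \<Longrightarrow> (f has_derivative frechet_derivative f (at x)) (at x)"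
  by (simp add: frechet_derivative_works[symmetric])

lemma Ck_on_const: "open S \<Longrightarrow> Ck_on k S (\<lambda>x. c)"
proof (induction k arbitrary: c)
  case (Suc k)
  then show ?case
    by (intro Ck_on_SucI[where f' = "\<lambda>x v. 0"]) auto
qed simp

lemma Ck_on_add:
  assumes "open S" "Ck_on k S f" "Ck_on k S g"
  shows "Ck_on k S (\<lambda>x. f x + g x)"
  using assms(2,3)
proof (induction k arbitrary: f g)
  case 0
  then show ?case by (simp add: continuous_on_add)
next
  case (Suc k)
  show ?case
    by (rule Ck_on_SucI[OF assms(1) has_derivative_add[OF
          Ck_on_has_derivative[OF Suc.prems(1)] Ck_on_has_derivative[OF Suc.prems(2)]]])
      (use Suc in auto)
qed

text \<open>By the product rule the derivative is a sum of two terms of the same bilinear shape,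
  each pairing one function with a derivative of the other. The general \<open>pr\<close> covers
  both products of reals and inner products.\<close>

lemma Ck_on_bilinear:
  assumes "bounded_bilinear pr" "open S" "Ck_on k S f" "Ck_on k S g"
  shows "Ck_on k S (\<lambda>x. pr (f x) (g x))"
  using assms(3,4)
proof (induction k arbitrary: f g)
  case 0
  then show ?case using bounded_bilinear.continuous_on[OF assms(1)] by simp
next
  case (Suc k)
  show ?case
    by (rule Ck_on_SucI[OF assms(2) bounded_bilinear.FDERIV[OF assms(1)
          Ck_on_has_derivative[OF Suc.prems(1)] Ck_on_has_derivative[OF Suc.prems(2)]]])
      (use Suc.prems in \<open>auto intro!: Ck_on_add Suc.IH assms(2) simp del: Ck_on.simps dest: Ck_on_SucD\<close>,
       auto)
qed

lemma Ck_on_Un: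
  assumes "open S" "open T" "Ck_on k S f" "Ck_on k T f"
  shows "Ck_on k (S \<union> T) f"
  using assms(3,4)
  by (induction k arbitrary: f) (auto simp: continuous_on_open_Un assms(1,2))

lemma Ck_on_subset: "Ck_on k S f \<Longrightarrow> T \<subseteq> S \<Longrightarrow> Ck_on k T f"
  by (induction k arbitrary: f) (auto intro: continuous_on_subset)

lemma smooth_on_cong:
  "open S \<Longrightarrow> (\<And>x. x \<in> S \<Longrightarrow> f x = g x) \<Longrightarrow> smooth_on S f \<Longrightarrow> smooth_on S g"
  unfolding smooth_on_def using Ck_on_cong by blast

lemma smooth_on_const: "open S \<Longrightarrow> smooth_on S (\<lambda>x. c)"
  unfolding smooth_on_def using Ck_on_const by blast

lemma smooth_on_Un: "open S \<Longrightarrow> open T \<Longrightarrow> smooth_on S f \<Longrightarrow> smooth_on T f \<Longrightarrow> smooth_on (S \<union> T) f"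
  unfolding smooth_on_def using Ck_on_Un by blast

lemma smooth_on_subset: "smooth_on S f \<Longrightarrow> T \<subseteq> S \<Longrightarrow> smooth_on T f"
  unfolding smooth_on_def using Ck_on_subset by blast

lemma smooth_on_mult:
  fixes f g :: "'e::real_normed_vector \<Rightarrow> real"
  shows "open S \<Longrightarrow> smooth_on S f \<Longrightarrow> smooth_on S g \<Longrightarrow> smooth_on S (\<lambda>x. f x * g x)"
  unfolding smooth_on_def using Ck_on_bilinear[OF bounded_bilinear_mult] by blast

lemma smooth_on_imp_differentiable: "smooth_on S f \<Longrightarrow> x \<in> S \<Longrightarrow> f differentiable (at x)"
  unfolding smooth_on_def by (metis Ck_on.simps(2))


section \<open>A smooth bump function\<close>

text \<open>The family is closed under differentiation up to linear combinations, so smoothness of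
  \<open>flat 0\<close> and of its compositions needs no general chain rule for \<open>C^k\<close> maps.\<close>

definition flat :: "nat \<Rightarrow> real \<Rightarrow> real" where
  "flat n t = (if t > 0 then exp (- (1 / t)) / t ^ n else 0)"

text \<open>From the right, \<open>exp (- (1 / t))\<close> decays faster than any power of
  \<open>t\<close>; from the left the function is identically zero.\<close>

lemma flat_tendsto_0: "(flat n \<longlongrightarrow> 0) (at 0)"
proof -
  have "(flat n \<longlongrightarrow> 0) (at_right 0)"
  proof (rule Lim_transform_eventually)
    show "((\<lambda>t::real. exp (- (1 / t)) / t ^ n) \<longlongrightarrow> 0) (at_right 0)"
      by real_asymp
    show "\<forall>\<^sub>F t in at_right 0. exp (- (1 / t)) / t ^ n = flat n t"
      by (auto simp: eventually_at_right_field flat_def intro!: exI[of _ 1])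
  qed
  moreover have "(flat n \<longlongrightarrow> 0) (at_left 0)"
    by (rule Lim_transform_eventually[OF tendsto_const])
      (auto simp: eventually_at_left_field flat_def intro!: exI[of _ "-1"])
  ultimately show ?thesis
    by (simp add: filterlim_split_at_real)
qed

lemma flat_has_derivative:
  "(flat n has_field_derivative flat (n + 2) t - real n * flat (n + 1) t) (at t)"
proof -
  consider "t > 0" | "t < 0" | "t = 0" by linarith
  then show ?thesis
  proof cases
    case 1
    have "((\<lambda>t. exp (- (1 / t)) / t ^ n) has_field_derivative
        (exp (- (1 / t)) * (1 / t^2) * t ^ n - exp (- (1 / t)) * (real n * t ^ (n - 1))) / (t ^ n * t ^ n)) (at t)"
      using 1 by (auto intro!: derivative_eq_intros simp: power2_eq_square)
    also have "(exp (- (1 / t)) * (1 / t^2) * t ^ n - exp (- (1 / t)) * (real n * t ^ (n - 1))) / (t ^ n * t ^ n)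
        = flat (n + 2) t - real n * flat (n + 1) t"
      using 1 by (cases n) (simp_all add: flat_def field_simps power2_eq_square)
    finally have "((\<lambda>t. exp (- (1 / t)) / t ^ n) has_field_derivative
        flat (n + 2) t - real n * flat (n + 1) t) (at t)" .
    then show ?thesis
      by (rule has_field_derivative_transform_within_open[of _ _ _ "{0<..}"])
        (use 1 in \<open>auto simp: flat_def\<close>)
  next
    case 2
    have "((\<lambda>t. 0) has_field_derivative flat (n + 2) t - real n * flat (n + 1) t) (at t)"
      using 2 by (simp add: flat_def)
    then show ?thesis
      by (rule has_field_derivative_transform_within_open[of _ _ _ "{..<0}"])
        (use 2 in \<open>auto simp: flat_def\<close>)
  next
    case 3
    \<comment> \<open>The difference quotient at \<open>0\<close> is again a member of the family,
      so its limit is already known. At \<open>h = 0\<close> both sides are \<open>0\<close> because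
      division by zero yields \<open>0\<close>.\<close>
    have "(\<lambda>h. (flat n h - flat n 0) / h) = flat (Suc n)"
      by (auto simp: flat_def fun_eq_iff)
    then show ?thesis
      using 3 flat_tendsto_0[of "Suc n"] by (simp add: has_field_derivative_iff flat_def)
  qed
qed

text \<open>The induction on \<open>k\<close> keeps \<open>n\<close> arbitrary, since
  differentiating \<open>flat n\<close> raises the index to \<open>n + 1\<close> and
  \<open>n + 2\<close>.\<close>

lemma Ck_on_flat_comp:
  fixes u :: "'e::real_normed_vector \<Rightarrow> real"
  assumes "open S" "Ck_on k S u"
  shows "Ck_on k S (\<lambda>x. flat n (u x))"
  using assms(2)
proof (induction k arbitrary: n)
  case 0
  have "continuous_on UNIV (flat n)"
    by (rule DERIV_continuous_on[OF has_field_derivative_at_within[OF flat_has_derivative]])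
  then show ?case
    using 0 by (auto intro: continuous_on_compose2)
next
  case (Suc k)
  let ?d = "\<lambda>x. flat (n + 2) (u x) + (- real n) * flat (n + 1) (u x)"
  note u = Ck_on_SucD[OF Suc.prems]
  show ?case
  proof (rule Ck_on_SucI[OF assms(1), where f' = "\<lambda>x v. ?d x * frechet_derivative u (at x) v"])
    fix x assume "x \<in> S"
    have "(flat n has_derivative (\<lambda>v. ?d x * v)) (at (u x))"
      using flat_has_derivative[of n "u x"]
      by (simp add: has_field_derivative_def)
    from has_derivative_compose[OF Ck_on_has_derivative[OF Suc.prems \<open>x \<in> S\<close>] this]
    show "((\<lambda>x. flat n (u x)) has_derivative (\<lambda>v. ?d x * frechet_derivative u (at x) v)) (at x)" .
  next
    fix v
    show "Ck_on k S (\<lambda>x. ?d x * frechet_derivative u (at x) v)"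
      using Suc.prems
      by (intro Ck_on_bilinear[OF bounded_bilinear_mult] Ck_on_add Ck_on_const Suc.IH u assms(1)) auto
  qed
qed

text \<open>The squared distance is an inner product, so bilinearity gives its smoothness. The map
  \<tau> stands for a transition map between two charts.\<close>

lemma smooth_on_radial_bump:
  fixes \<tau> :: "'e::real_normed_vector \<Rightarrow> 'f::real_inner"
  assumes "open S" "smooth_on S \<tau>"
  shows "smooth_on S (\<lambda>x. flat 0 (r - (\<tau> x - c) \<bullet> (\<tau> x - c)))"
  unfolding smooth_on_def
proof
  fix k
  have "Ck_on k S (\<lambda>x. \<tau> x + (- c))"
    using assms by (intro Ck_on_add Ck_on_const) (auto simp: smooth_on_def)
  then have "Ck_on k S (\<lambda>x. r + (- 1) * ((\<tau> x + (- c)) \<bullet> (\<tau> x + (- c))))"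
    by (intro Ck_on_add[OF assms(1) Ck_on_const Ck_on_bilinear[OF bounded_bilinear_mult _ Ck_on_const]]
        Ck_on_bilinear[OF bounded_bilinear_inner] assms(1))
  from Ck_on_flat_comp[OF assms(1) this]
  show "Ck_on k S (\<lambda>x. flat 0 (r - (\<tau> x - c) \<bullet> (\<tau> x - c)))"
    by simp
qed


section \<open>Smooth functions and tangent spaces in charts\<close>

lemma chart_open:
  assumes "smooth_manifold A" "(U, \<phi>) \<in> A"
  shows "open U" "open (\<phi> ` U)" "homeomorphism U (\<phi> ` U) \<phi> (inv_into U \<phi>)"
  using assms by (auto simp: smooth_manifold_def)

lemma chart_inv:
  assumes "smooth_manifold A" "(U, \<phi>) \<in> A" "q \<in> U"
  shows "inv_into U \<phi> (\<phi> q) = q"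
  using chart_open(3)[OF assms(1,2)] assms(3) by (simp add: homeomorphism_def)

lemma chart_image_open:
  assumes "smooth_manifold A" "(U, \<phi>) \<in> A" "open W"
  shows "open (\<phi> ` (U \<inter> W))"
proof -
  have "openin (top_of_set U) (U \<inter> W)"
    using assms(3) by (simp add: openin_open_Int)
  from homeomorphism_imp_open_map[OF chart_open(3)[OF assms(1,2)] this]
  show ?thesis
    using chart_open(2)[OF assms(1,2)] openin_open_trans by blast
qed

lemma smooth_fun_on_cong:
  assumes "smooth_manifold A" "open W" "\<And>q. q \<in> W \<Longrightarrow> f q = h q" "smooth_fun_on A W f"
  shows "smooth_fun_on A W h"
  unfolding smooth_fun_on_def
proof clarify
  fix U \<phi> assume U: "(U, \<phi>) \<in> A"
  show "smooth_on (\<phi> ` (U \<inter> W)) (h \<circ> inv_into U \<phi>)"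
  proof (rule smooth_on_cong)
    show "smooth_on (\<phi> ` (U \<inter> W)) (f \<circ> inv_into U \<phi>)"
      using assms(4) U by (auto simp: smooth_fun_on_def)
  qed (use assms chart_inv[OF assms(1) U] in \<open>auto intro!: chart_image_open[OF _ U]\<close>)
qed

lemma smooth_fun_on_const: "smooth_manifold A \<Longrightarrow> open W \<Longrightarrow> smooth_fun_on A W (\<lambda>q. c)"
  by (auto simp: smooth_fun_on_def o_def intro!: smooth_on_const chart_image_open)

lemma smooth_fun_on_mult:
  "smooth_manifold A \<Longrightarrow> open W \<Longrightarrow> smooth_fun_on A W f \<Longrightarrow> smooth_fun_on A W h \<Longrightarrow>
    smooth_fun_on A W (\<lambda>q. f q * h q)"
  unfolding smooth_fun_on_def o_def by (fast intro!: smooth_on_mult chart_image_open)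

lemma smooth_fun_on_Un:
  assumes "smooth_manifold A" "open W" "open W'" "smooth_fun_on A W f" "smooth_fun_on A W' f"
  shows "smooth_fun_on A (W \<union> W') f"
  using assms unfolding smooth_fun_on_def Int_Un_distrib image_Un
  by (fast intro!: smooth_on_Un chart_image_open)

lemma smooth_fun_on_subset: "smooth_fun_on A W f \<Longrightarrow> W' \<subseteq> W \<Longrightarrow> smooth_fun_on A W' f"
  unfolding smooth_fun_on_def by (fast intro: smooth_on_subset)

text \<open>The tangent vector at \<open>p\<close> with coordinates \<open>w\<close> in one fixed
  chart, taken as a function of \<open>w\<close> so that its linearity and its range can be
  discussed.\<close>

definition coord_derivation ::
  "('a, 'e::real_normed_vector) atlas \<Rightarrow> 'a set \<Rightarrow> ('a \<Rightarrow> 'e) \<Rightarrow> 'a \<Rightarrow> 'e \<Rightarrow> 'a tvec" where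
  "coord_derivation A U \<phi> p w = (\<lambda>f.
     if f \<in> smooth_funs A then frechet_derivative (f \<circ> inv_into U \<phi>) (at (\<phi> p)) w else 0)"

lemma smooth_fun_has_derivative:
  assumes "(U, \<phi>) \<in> A" "p \<in> U" "f \<in> smooth_funs A"
  shows "((f \<circ> inv_into U \<phi>) has_derivative frechet_derivative (f \<circ> inv_into U \<phi>) (at (\<phi> p))) (at (\<phi> p))"
  using assms
  by (auto simp: smooth_fun_on_def frechet_derivative_works[symmetric] intro!: smooth_on_imp_differentiable)

text \<open>Chain rule: near \<open>p\<close>, the coordinate expression of \<open>f\<close> in one
  chart is its expression in the other chart composed with the transition map.\<close>

lemma coord_derivation_change:
  assumes A: "smooth_manifold A" and U: "(U, \<phi>) \<in> A" "p \<in> U" and V: "(V, \<psi>) \<in> A" "p \<in> V"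
  shows "coord_derivation A V \<psi> p w =
    coord_derivation A U \<phi> p (frechet_derivative (\<phi> \<circ> inv_into V \<psi>) (at (\<psi> p)) w)"
proof
  fix f
  let ?\<tau> = "\<phi> \<circ> inv_into V \<psi>"
  show "coord_derivation A V \<psi> p w f =
    coord_derivation A U \<phi> p (frechet_derivative ?\<tau> (at (\<psi> p)) w) f"
  proof (cases "f \<in> smooth_funs A")
    case True
    have "smooth_on (\<psi> ` (V \<inter> U)) ?\<tau>"
      using A U V by (auto simp: smooth_manifold_def)
    then have \<tau>: "(?\<tau> has_derivative frechet_derivative ?\<tau> (at (\<psi> p))) (at (\<psi> p))"
      using U V by (auto simp: frechet_derivative_works[symmetric] intro!: smooth_on_imp_differentiable)
    have p: "?\<tau> (\<psi> p) = \<phi> p"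
      using chart_inv[OF A V] by simp
    have "((f \<circ> inv_into U \<phi>) \<circ> ?\<tau> has_derivative
        frechet_derivative (f \<circ> inv_into U \<phi>) (at (\<phi> p)) \<circ> frechet_derivative ?\<tau> (at (\<psi> p))) (at (\<psi> p))"
      by (rule diff_chain_at[OF \<tau>]) (use p smooth_fun_has_derivative[OF U True] in simp)
    then have "((f \<circ> inv_into V \<psi>) has_derivative
        frechet_derivative (f \<circ> inv_into U \<phi>) (at (\<phi> p)) \<circ> frechet_derivative ?\<tau> (at (\<psi> p))) (at (\<psi> p))"
    proof (rule has_derivative_transform_within_open)
      show "open (\<psi> ` (V \<inter> U))"
        using chart_image_open[OF A V(1)] chart_open(1)[OF A U(1)] by blast
    qed (use U V chart_inv[OF A U(1)] chart_inv[OF A V(1)] in auto)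
    from frechet_derivative_at[OF this] show ?thesis
      using True by (simp add: coord_derivation_def fun_eq_iff)
  qed (simp add: coord_derivation_def)
qed

text \<open>The definition admits every chart around \<open>p\<close>; the change of charts reduces
  all of them to a single one. This makes the tangent space a linear image of the model
  space.\<close>

lemma tangent_space_eq_range:
  assumes "smooth_manifold A" "(U, \<phi>) \<in> A" "p \<in> U"
  shows "tangent_space A p = range (coord_derivation A U \<phi> p)"
proof -
  have eq: "tangent_space A p = {v. \<exists>(V, \<psi>)\<in>A. p \<in> V \<and> (\<exists>w. v = coord_derivation A V \<psi> p w)}"
    by (simp add: tangent_space_def coord_derivation_def)
  have "coord_derivation A V \<psi> p w \<in> range (coord_derivation A U \<phi> p)"
    if "(V, \<psi>) \<in> A" "p \<in> V" for V \<psi> w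
    by (subst coord_derivation_change[OF assms that]) (rule rangeI)
  then have "tangent_space A p \<subseteq> range (coord_derivation A U \<phi> p)"
    unfolding eq by fast
  moreover have "range (coord_derivation A U \<phi> p) \<subseteq> tangent_space A p"
    using assms(2,3) unfolding eq by fast
  ultimately show ?thesis ..
qed

lemma linear_coord_derivation:
  assumes "(U, \<phi>) \<in> A" "p \<in> U"
  shows "linear (coord_derivation A U \<phi> p)"
proof
  fix v w :: 'b and r :: real
  show "coord_derivation A U \<phi> p (v + w) = coord_derivation A U \<phi> p v + coord_derivation A U \<phi> p w"
    "coord_derivation A U \<phi> p (r *\<^sub>R v) = r *\<^sub>R coord_derivation A U \<phi> p v"
    using has_derivative_linear[OF smooth_fun_has_derivative[OF assms]]
    by (auto simp: coord_derivation_def fun_eq_iff linear_add linear_cmul)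
qed

lemma ex_chart:
  assumes "smooth_manifold A"
  obtains U \<phi> where "(U, \<phi>) \<in> A" "p \<in> U"
proof -
  have "p \<in> (\<Union>(U, \<phi>)\<in>A. U)"
    using assms by (simp add: smooth_manifold_def)
  then show ?thesis
    using that by auto
qed

lemma subspace_tangent_space:
  assumes "smooth_manifold A"
  shows "subspace (tangent_space A p)"
proof -
  obtain U \<phi> where "(U, \<phi>) \<in> A" "p \<in> U"
    using ex_chart[OF assms] by metis
  then show ?thesis
    using linear_subspace_image[OF linear_coord_derivation subspace_UNIV]
    by (simp add: tangent_space_eq_range[OF assms])
qed

lemma tangent_space_finite_span:
  assumes "smooth_manifold A"
  shows "\<exists>C. finite C \<and> tangent_space A p \<subseteq> span C"
proof -
  obtain U \<phi> where U: "(U, \<phi>) \<in> A" "p \<in> U"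
    using ex_chart[OF assms] by metis
  obtain S :: "'b set" where S: "finite S" "span S = UNIV"
    using assms by (auto simp: smooth_manifold_def)
  have "tangent_space A p = span (coord_derivation A U \<phi> p ` S)"
    using linear_span_image[OF linear_coord_derivation[OF U], of S] S(2)
    by (simp add: tangent_space_eq_range[OF assms U])
  then show ?thesis
    using S(1) by blast
qed


section \<open>Global sections through a given point\<close>

text \<open>In a chart, \<rho> is a radial bump supported in a closed ball, and \<open>K\<close> is
  the preimage of that ball. Smoothness is checked on the chart domain and on the complement of
  \<open>K\<close>, two open sets that cover the manifold.\<close>

lemma ex_bump_function:
  fixes A :: "('a::{t2_space, second_countable_topology}, 'e::euclidean_space) atlas"
  assumes A: "smooth_manifold A" and W: "open W" "p \<in> W"
  obtains \<rho> K where "smooth_fun_on A UNIV \<rho>" "\<rho> p \<noteq> 0" "closed K" "K \<subseteq> W"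
    "\<And>q. q \<notin> K \<Longrightarrow> \<rho> q = 0"
proof -
  obtain U \<phi> where U: "(U, \<phi>) \<in> A" "p \<in> U"
    using ex_chart[OF A] by metis
  have "open (\<phi> ` (U \<inter> W))" "\<phi> p \<in> \<phi> ` (U \<inter> W)"
    using chart_image_open[OF A U(1) W(1)] U(2) W(2) by auto
  then obtain r where r: "r > 0" "cball (\<phi> p) r \<subseteq> \<phi> ` (U \<inter> W)"
    unfolding open_contains_cball by meson
  define K where "K = inv_into U \<phi> ` cball (\<phi> p) r"
  define \<rho> where "\<rho> q = (if q \<in> U then flat 0 (r^2 - (\<phi> q - \<phi> p) \<bullet> (\<phi> q - \<phi> p)) else 0)" for q
  have "continuous_on (cball (\<phi> p) r) (inv_into U \<phi>)"
    using chart_open(3)[OF A U(1)] r(2) by (auto simp: homeomorphism_def intro: continuous_on_subset)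
  \<comment> \<open>\<open>K\<close> is a continuous image of a compact ball, hence compact, hence
    closed in the Hausdorff manifold.\<close>
  then have closed: "closed K"
    unfolding K_def by (intro compact_imp_closed compact_continuous_image compact_cball)
  have K: "K \<subseteq> U \<inter> W"
    using r(2) chart_inv[OF A U(1)] by (fastforce simp: K_def)
  have off: "\<rho> q = 0" if "q \<notin> K" for q
  proof (cases "q \<in> U")
    case True
    have "\<phi> q \<notin> cball (\<phi> p) r"
      using that chart_inv[OF A U(1) True] unfolding K_def by (metis imageI)
    then have "r < norm (\<phi> q - \<phi> p)"
      by (simp add: dist_norm norm_minus_commute)
    then have "r^2 \<le> (\<phi> q - \<phi> p) \<bullet> (\<phi> q - \<phi> p)"
      using r(1) by (metis less_imp_le power2_norm_eq_inner power_mono)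
    then show ?thesis
      by (simp add: \<rho>_def flat_def)
  qed (simp add: \<rho>_def)
  have "smooth_fun_on A U \<rho>"
    unfolding smooth_fun_on_def
  proof clarify
    fix V \<psi> assume V: "(V, \<psi>) \<in> A"
    let ?\<tau> = "\<phi> \<circ> inv_into V \<psi>"
    have op: "open (\<psi> ` (V \<inter> U))"
      using chart_image_open[OF A V] chart_open(1)[OF A U(1)] by blast
    have "smooth_on (\<psi> ` (V \<inter> U)) ?\<tau>"
      using A U V by (auto simp: smooth_manifold_def)
    from smooth_on_radial_bump[OF op this]
    show "smooth_on (\<psi> ` (V \<inter> U)) (\<rho> \<circ> inv_into V \<psi>)"
      by (rule smooth_on_cong[OF op, rotated]) (use chart_inv[OF A V] in \<open>auto simp: \<rho>_def\<close>)
  qed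
  moreover have "smooth_fun_on A (- K) \<rho>"
    by (rule smooth_fun_on_cong[OF A _ _ smooth_fun_on_const[OF A]]) (use closed off in auto)
  ultimately have "smooth_fun_on A (U \<union> - K) \<rho>"
    using closed by (intro smooth_fun_on_Un[OF A chart_open(1)[OF A U(1)]]) auto
  moreover have "U \<union> - K = UNIV"
    using K by auto
  ultimately have "smooth_fun_on A UNIV \<rho>"
    by simp
  moreover have "\<rho> p \<noteq> 0"
    using r(1) U(2) by (simp add: \<rho>_def flat_def)
  ultimately show ?thesis
    using that closed K off by blast
qed

text \<open>Applied to a smooth function, the extended field is a product of smooth functions on
  \<open>W\<close> and zero on the complement of \<open>K\<close>; the two open sets cover the
  manifold.\<close>

lemma vfield_extend_by_zero:
  assumes A: "smooth_manifold A" and W: "open W" "smooth_vfield_on A W X"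
    and \<rho>: "smooth_fun_on A UNIV \<rho>" "closed K" "K \<subseteq> W" "\<And>q. q \<notin> K \<Longrightarrow> \<rho> q = 0"
  shows "(\<lambda>q. if q \<in> W then \<rho> q *\<^sub>R X q else 0) \<in> vfields A"
proof -
  let ?Y = "\<lambda>q. if q \<in> W then \<rho> q *\<^sub>R X q else 0"
  have "?Y q \<in> tangent_space A q" for q
    using W(2) subspace_tangent_space[OF A] by (auto simp: smooth_vfield_on_def subspace_def)
  moreover have "smooth_fun_on A UNIV (\<lambda>q. ?Y q f)" if "f \<in> smooth_funs A" for f
  proof -
    have "smooth_fun_on A W (\<lambda>q. \<rho> q * X q f)"
      using W(2) that \<rho>(1)
      by (intro smooth_fun_on_mult[OF A W(1)]) (auto simp: smooth_vfield_on_def intro: smooth_fun_on_subset)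
    then have "smooth_fun_on A W (\<lambda>q. ?Y q f)"
      by (rule smooth_fun_on_cong[OF A W(1), rotated]) auto
    moreover have "smooth_fun_on A (- K) (\<lambda>q. ?Y q f)"
      by (rule smooth_fun_on_cong[OF A _ _ smooth_fun_on_const[OF A]]) (use \<rho>(2,4) in auto)
    ultimately have "smooth_fun_on A (W \<union> - K) (\<lambda>q. ?Y q f)"
      using \<rho>(2) by (intro smooth_fun_on_Un[OF A W(1)]) auto
    moreover have "W \<union> - K = UNIV"
      using \<rho>(3) by auto
    ultimately show ?thesis
      by simp
  qed
  ultimately show ?thesis
    by (simp add: smooth_vfield_on_def)
qed

text \<open>The first field of a local frame exists because \<open>k \<ge> 1\<close> and vanishes
  nowhere on \<open>W\<close>, since an independent set does not contain zero. A bump function makes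
  it global.\<close>

lemma ex_nonzero_section:
  fixes A :: "('a::{t2_space, second_countable_topology}, 'e::euclidean_space) atlas"
  assumes A: "smooth_manifold A" and D: "smooth_distribution A k D" "k \<ge> 1"
  obtains X where "X \<in> sections A D" "X p \<noteq> 0"
proof -
  obtain W X where W: "open W" "p \<in> W" and sm: "\<forall>i<k. smooth_vfield_on A W (X i)"
    and fr: "\<forall>q\<in>W. inj_on (\<lambda>i. X i q) {..<k} \<and> independent ((\<lambda>i. X i q) ` {..<k}) \<and>
               D q = span ((\<lambda>i. X i q) ` {..<k})"
    using D(1) unfolding smooth_distribution_def by metis
  have sub: "subspace (D q)" for q
    using D(1) unfolding smooth_distribution_def by (metis subspace_span)
  obtain \<rho> K where \<rho>: "smooth_fun_on A UNIV \<rho>" "\<rho> p \<noteq> 0" "closed K" "K \<subseteq> W"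
    "\<And>q. q \<notin> K \<Longrightarrow> \<rho> q = 0"
    using ex_bump_function[OF A W] by metis
  let ?Y = "\<lambda>q. if q \<in> W then \<rho> q *\<^sub>R X 0 q else 0"
  have "?Y \<in> vfields A"
    by (rule vfield_extend_by_zero[OF A W(1) _ \<rho>(1,3-5)]) (use sm D(2) in auto)
  moreover have "?Y q \<in> D q" for q
  proof (cases "q \<in> W")
    case True
    then have "X 0 q \<in> D q"
      using fr D(2) by (auto intro!: span_base)
    then show ?thesis
      using sub True by (simp add: subspace_scale)
  qed (simp add: sub subspace_0)
  moreover have "X 0 p \<noteq> 0"
  proof -
    have "X 0 p \<in> (\<lambda>i. X i p) ` {..<k}"
      using D(2) by auto
    then show ?thesis
      using fr W(2) dependent_zero by metis
  qed
  ultimately show ?thesis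
    using that[of ?Y] \<rho>(2) W(2) by (auto simp: sections_def)
qed

section \<open>Orthogonal projections\<close>

text \<open>A tangent space is only a subset of a function type, and the metric is controlled on
  that subset alone, so the inner product is taken relative to a carrier \<open>T\<close>.\<close>

locale inner_product_on =
  fixes T :: "'v::real_vector set" and g :: "'v \<Rightarrow> 'v \<Rightarrow> real"
  assumes subspace_T: "subspace T"
    and finite_span: "\<exists>C. finite C \<and> T \<subseteq> span C"
    and lin: "u \<in> T \<Longrightarrow> v \<in> T \<Longrightarrow> w \<in> T \<Longrightarrow> g (a *\<^sub>R u + b *\<^sub>R v) w = a * g u w + b * g v w"
    and sym: "u \<in> T \<Longrightarrow> v \<in> T \<Longrightarrow> g u v = g v u"
    and pos: "u \<in> T \<Longrightarrow> u \<noteq> 0 \<Longrightarrow> g u u > 0"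
begin

lemma closed [simp]:
  "0 \<in> T" "u \<in> T \<Longrightarrow> v \<in> T \<Longrightarrow> u + v \<in> T" "u \<in> T \<Longrightarrow> v \<in> T \<Longrightarrow> u - v \<in> T"
  "u \<in> T \<Longrightarrow> a *\<^sub>R u \<in> T" "u \<in> T \<Longrightarrow> - u \<in> T"
  using subspace_T by (auto simp: subspace_0 subspace_add subspace_diff subspace_scale subspace_neg)

lemma bilinear_left:
  assumes "u \<in> T" "v \<in> T" "w \<in> T"
  shows "g (u + v) w = g u w + g v w" "g (u - v) w = g u w - g v w"
    "g (a *\<^sub>R u) w = a * g u w" "g (- u) w = - g u w"
  using lin[OF assms, of 1 1] lin[OF assms, of 1 "-1"] lin[OF assms, of a 0] lin[OF assms, of "-1" 0] by simp_all

lemma bilinear_right: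
  assumes "u \<in> T" "v \<in> T" "w \<in> T"
  shows "g w (u + v) = g w u + g w v" "g w (u - v) = g w u - g w v"
    "g w (a *\<^sub>R u) = a * g w u" "g w (- u) = - g w u"
  using bilinear_left[OF assms] assms by (simp_all add: sym[of w])

lemma zero_left: "w \<in> T \<Longrightarrow> g 0 w = 0"
  using bilinear_left(3)[of w w w 0] by simp

lemma zero_right: "w \<in> T \<Longrightarrow> g w 0 = 0"
  using bilinear_right(3)[of w w w 0] by simp

lemma eq_0_iff: "u \<in> T \<Longrightarrow> g u u = 0 \<longleftrightarrow> u = 0"
  using pos[of u] zero_left[of 0] by (metis closed(1) less_irrefl)

text \<open>Gram-Schmidt: the part \<open>c'\<close> of the new vector orthogonal to the old span
  contributes one further term \<open>t *\<^sub>R c'\<close> to the projection.\<close>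

lemma ex_proj_span:
  assumes "finite C" "C \<subseteq> T" "v \<in> T"
  shows "\<exists>u\<in>span C. \<forall>w\<in>span C. g w (v - u) = 0"
  using assms
proof (induction C arbitrary: v rule: finite_induct)
  case empty
  then show ?case by (simp add: zero_left)
next
  case (insert c C)
  have span_T: "span C \<subseteq> T"
    using insert.prems subspace_T by (simp add: span_minimal)
  obtain c0 where c0: "c0 \<in> span C" "\<forall>w\<in>span C. g w (c - c0) = 0"
    using insert.IH[of c] insert.prems by auto
  obtain u0 where u0: "u0 \<in> span C" "\<forall>w\<in>span C. g w (v - u0) = 0"
    using insert.IH[of v] insert.prems by auto
  define c' where "c' = c - c0"
  have T: "c \<in> T" "c0 \<in> T" "u0 \<in> T" "c' \<in> T" "v \<in> T"
    using insert.prems c0 u0 span_T by (auto simp: c'_def)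
  \<comment> \<open>If \<open>c' = 0\<close>, division by zero makes \<open>t = 0\<close>, which is
    harmless because both sides of the equation for \<open>g c' v\<close> below are then
    zero.\<close>
  define t where "t = g v c' / g c' c'"
  have c'_span: "c' \<in> span (insert c C)"
    using c0(1) unfolding c'_def by (meson insertI1 span_base span_diff span_mono subset_insertI subsetD)
  have "u0 + t *\<^sub>R c' \<in> span (insert c C)"
    using u0(1) c'_span by (meson span_add span_mono span_scale subset_insertI subsetD)
  moreover have "g w (v - (u0 + t *\<^sub>R c')) = 0" if w: "w \<in> span (insert c C)" for w
  proof -
    obtain a where a: "w - a *\<^sub>R c \<in> span C"
      using w span_breakdown_eq[of w c C] by auto
    \<comment> \<open>Rewrites \<open>w\<close> as \<open>e + a *\<^sub>R c'\<close> with
      \<open>e\<close> in the old span, so that orthogonality can be tested on the two parts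
      separately.\<close>
    define e where "e = w - a *\<^sub>R c + a *\<^sub>R c0"
    have e: "e \<in> span C"
      unfolding e_def using a c0(1) by (simp add: span_add span_scale)
    have eT: "e \<in> T"
      using e span_T by auto
    have w_eq: "w = e + a *\<^sub>R c'"
      by (simp add: e_def c'_def algebra_simps)
    have "g e (v - u0) = 0" "g e c' = 0" "g u0 c' = 0"
      using e u0 c0 by (auto simp: c'_def)
    moreover have "g c' v = t * g c' c'"
      using eq_0_iff[OF T(4)] T by (cases "c' = 0") (auto simp: t_def sym[of c' v] zero_left zero_right)
    ultimately show ?thesis
      using T eT by (simp add: w_eq bilinear_left bilinear_right sym[of c' u0])
  qed
  ultimately show ?case by blast
qed

definition proj :: "'v set \<Rightarrow> 'v \<Rightarrow> 'v" where
  "proj S v = (THE u. u \<in> S \<and> (\<forall>w\<in>S. g w (v - u) = 0))"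

text \<open>Two candidates differ by an element of \<open>S\<close> that is orthogonal to itself,
  and positive definiteness makes it zero.\<close>

lemma proj_unique:
  assumes "subspace S" "S \<subseteq> T" "v \<in> T" "u \<in> S" "\<And>w. w \<in> S \<Longrightarrow> g w (v - u) = 0"
  shows "proj S v = u"
  unfolding proj_def
proof (rule the_equality)
  fix u' assume u': "u' \<in> S \<and> (\<forall>w\<in>S. g w (v - u') = 0)"
  have d: "u - u' \<in> S"
    using u' assms by (simp add: subspace_diff)
  have T: "u \<in> T" "u' \<in> T"
    using u' assms by auto
  have "(v - u') - (v - u) = u - u'"
    by simp
  then have "g (u - u') (u - u') = g (u - u') (v - u') - g (u - u') (v - u)"
    using bilinear_right(2)[of "v - u'" "v - u" "u - u'"] T assms(3) by simp
  also have "\<dots> = 0"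
    using u' assms(5) d by simp
  finally show "u' = u"
    using eq_0_iff[of "u - u'"] T by simp
qed (use assms in auto)

text \<open>A basis of \<open>S\<close> is finite, being independent inside the span of a finite
  set, so the projection exists by \<open>ex_proj_span\<close>; uniqueness identifies it with the
  definite description.\<close>

lemma proj:
  assumes "subspace S" "S \<subseteq> T" "v \<in> T"
  shows "proj S v \<in> S" "w \<in> S \<Longrightarrow> g w (proj S v) = g w v"
proof -
  obtain C where C: "finite C" "T \<subseteq> span C"
    using finite_span by auto
  obtain E where E: "E \<subseteq> S" "independent E" "S \<subseteq> span E"
    using basis_exists by metis
  then have "finite E"
    using independent_span_bound[OF C(1) E(2)] C(2) assms(2) by auto
  moreover have "span E = S"
    using E assms(1) by (simp add: span_minimal subset_antisym)
  ultimately obtain u where u: "u \<in> S" "\<forall>w\<in>S. g w (v - u) = 0"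
    using ex_proj_span[of E v] E(1) assms by auto
  have eq: "proj S v = u"
    by (rule proj_unique[OF assms u(1)]) (use u in auto)
  show "proj S v \<in> S"
    using u eq by simp
  assume w: "w \<in> S"
  then have "g w v - g w u = 0"
    using u assms bilinear_right(2)[of v u w] by auto
  then show "g w (proj S v) = g w v"
    using eq by simp
qed

lemma proj_id: "subspace S \<Longrightarrow> S \<subseteq> T \<Longrightarrow> v \<in> S \<Longrightarrow> proj S v = v"
  by (rule proj_unique) (auto simp: zero_right)

lemma proj_eq_0:
  "subspace S \<Longrightarrow> S \<subseteq> T \<Longrightarrow> v \<in> T \<Longrightarrow> (\<And>w. w \<in> S \<Longrightarrow> g w v = 0) \<Longrightarrow> proj S v = 0"
  by (rule proj_unique) (auto simp: subspace_0)

lemma proj_linear: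
  assumes S: "subspace S" "S \<subseteq> T" and "u \<in> T" "v \<in> T"
  shows "proj S (a *\<^sub>R u + b *\<^sub>R v) = a *\<^sub>R proj S u + b *\<^sub>R proj S v"
proof (rule proj_unique[OF S])
  have T: "proj S u \<in> T" "proj S v \<in> T"
    using proj(1)[OF S] S(2) assms by auto
  show "a *\<^sub>R proj S u + b *\<^sub>R proj S v \<in> S"
    using proj(1)[OF S] S(1) assms by (simp add: subspace_add subspace_scale)
  fix w assume "w \<in> S"
  then show "g w (a *\<^sub>R u + b *\<^sub>R v - (a *\<^sub>R proj S u + b *\<^sub>R proj S v)) = 0"
    using T S(2) assms proj(2)[OF S, of _ w] by (auto simp: bilinear_right)
qed (use assms in auto)

lemma subspace_orth: "S \<subseteq> T \<Longrightarrow> V \<subseteq> T \<Longrightarrow> subspace V \<Longrightarrow> subspace {v \<in> V. \<forall>u\<in>S. g u v = 0}"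
  unfolding subspace_def by (auto simp: bilinear_right subset_iff zero_right)

end

lemma inner_product_on_tangent_space:
  assumes "riemannian_manifold A g"
  shows "inner_product_on (tangent_space A p) (g p)"
proof -
  have A: "smooth_manifold A" and g: "riemannian_metric A g"
    using assms by (auto simp: riemannian_manifold_def)
  show ?thesis
    using g unfolding riemannian_metric_def
    by (intro inner_product_on.intro subspace_tangent_space[OF A] tangent_space_finite_span[OF A]) simp_all
qed

lemma orth_proj_eq_proj:
  assumes "riemannian_manifold A g"
  shows "orth_proj g p S v = inner_product_on.proj (g p) S v"
  unfolding orth_proj_def inner_product_on.proj_def[OF inner_product_on_tangent_space[OF assms]] ..

section \<open>Totally umbilical fibers\<close>

lemma vertical_subset: "vertical A B F p \<subseteq> tangent_space A p"
  by (auto simp: vertical_def)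

lemma horizontal_subset: "horizontal A g B F p \<subseteq> tangent_space A p"
  by (auto simp: horizontal_def orth_in_def)

lemma subspace_vertical:
  assumes "smooth_manifold A"
  shows "subspace (vertical A B F p)"
  using subspace_tangent_space[OF assms, of p]
  by (auto simp: vertical_def differential_def subspace_def fun_eq_iff)

lemma subspace_horizontal:
  assumes "riemannian_manifold A g"
  shows "subspace (horizontal A g B F p)"
proof -
  interpret inner_product_on "tangent_space A p" "g p"
    by (rule inner_product_on_tangent_space[OF assms])
  show ?thesis
    using assms subspace_vertical[of A B F p] vertical_subset[of A B F p] subspace_T
    unfolding horizontal_def orth_in_def by (auto simp: riemannian_manifold_def intro!: subspace_orth)
qed

lemma zero_vfield:
  assumes "smooth_manifold A"
  shows "0 \<in> vfields A"
  using subspace_tangent_space[OF assms] smooth_fun_on_const[OF assms, of UNIV 0]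
  by (simp add: smooth_vfield_on_def subspace_0)

text \<open>For vertical fields only the horizontal part of \<open>nab U V\<close> survives in the
  O'Neill tensor, and projecting to the horizontal space does not change the inner product with a
  horizontal \<open>Y\<close>.\<close>

lemma inner_umbilical:
  assumes A: "riemannian_manifold A g" and lc: "levi_civita A g nab"
    and H: "totally_umbilical_fibers A g nab B F H"
    and U: "U \<in> sections A (vertical A B F)" and V: "V \<in> sections A (vertical A B F)"
    and Y: "Y \<in> horizontal A g B F p"
  shows "g p Y (nab U V p) = g p (U p) (V p) * g p Y (H p)"
proof -
  have sm: "smooth_manifold A"
    using A by (simp add: riemannian_manifold_def)
  interpret inner_product_on "tangent_space A q" "g q" for q
    by (rule inner_product_on_tangent_space[OF A])
  note ver = subspace_vertical[OF sm, of B F] vertical_subset[of A B F]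
  note hor = subspace_horizontal[OF A, of B F] horizontal_subset[of A g B F]
  have UV: "U \<in> vfields A" "V \<in> vfields A" "U q \<in> vertical A B F q" "V q \<in> vertical A B F q" for q
    using U V by (auto simp: sections_def)
  have "ver_proj A g B F q (U q) = U q" "ver_proj A g B F q (V q) = V q" for q
    unfolding ver_proj_def orth_proj_eq_proj[OF A] using UV by (auto intro!: proj_id ver)
  moreover have "hor_proj A g B F q (V q) = 0" for q
    unfolding hor_proj_def orth_proj_eq_proj[OF A]
  proof (rule proj_eq_0[OF hor])
    show Vq: "V q \<in> tangent_space A q"
      using UV ver(2) by blast
    fix w assume "w \<in> horizontal A g B F q"
    then show "g q w (V q) = 0"
      using UV Vq by (auto simp: horizontal_def orth_in_def sym[of w])
  qed
  ultimately have T: "oneill_T A g nab B F U V p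
      = hor_proj A g B F p (nab U V p) + ver_proj A g B F p (nab U (\<lambda>q. 0) p)"
    by (simp add: oneill_T_def Let_def)
  \<comment> \<open>Additivity of the connection forces \<open>nab U 0 = 0\<close>, which removes
    the second term of the O'Neill tensor.\<close>
  have "nab U (0 + 0) = nab U 0 + nab U 0"
    using lc UV(1) zero_vfield[OF sm] unfolding levi_civita_def by blast
  then have "nab U 0 = 0"
    by (metis add.right_neutral add_left_cancel)
  moreover have "(\<lambda>q. 0) = (0 :: 'a vfield)"
    by (simp add: fun_eq_iff)
  ultimately have "nab U (\<lambda>q. 0) = 0"
    by (simp only:)
  moreover have "ver_proj A g B F p 0 = 0"
    unfolding ver_proj_def orth_proj_eq_proj[OF A]
    by (intro proj_id ver) (use ver in \<open>simp add: subspace_0\<close>)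
  moreover have "oneill_T A g nab B F U V = fmult (\<lambda>p. g p (U p) (V p)) H"
    using H U V by (simp add: totally_umbilical_fibers_def)
  ultimately have "hor_proj A g B F p (nab U V p) = g p (U p) (V p) *\<^sub>R H p"
    using T by (simp add: fmult_def)
  moreover have "nab U V \<in> vfields A"
    using lc UV(1,2) by (simp add: levi_civita_def)
  then have "nab U V p \<in> tangent_space A p"
    by (simp add: smooth_vfield_on_def)
  then have "g p Y (hor_proj A g B F p (nab U V p)) = g p Y (nab U V p)"
    unfolding hor_proj_def orth_proj_eq_proj[OF A] using proj(2)[OF hor _ Y] by blast
  moreover have "H \<in> sections A (horizontal A g B F)"
    using H by (simp add: totally_umbilical_fibers_def mean_curvature_field_def)
  then have "H p \<in> tangent_space A p"
    by (auto simp: sections_def smooth_vfield_on_def)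
  moreover have "Y \<in> tangent_space A p"
    using Y hor(2) by blast
  ultimately show ?thesis
    by (simp add: bilinear_right)
qed

text \<open>On the diagonal the nearly Kaehler identity says that twice the derivative of
  \<open>J\<close> vanishes.\<close>

lemma nearly_kaehler_nabla_J_self:
  assumes "nearly_kaehler_manifold A g J nab" "X \<in> vfields A"
  shows "nab X (\<lambda>q. J q (X q)) p = J p (nab X X p)"
proof -
  have "nabla_J nab J X X + nabla_J nab J X X = 0"
    using assms by (simp add: nearly_kaehler_manifold_def)
  then have "nabla_J nab J X X p f + nabla_J nab J X X p f = 0" for f
    by (simp add: fun_eq_iff)
  then have "nabla_J nab J X X p = 0"
    by (simp add: fun_eq_iff)
  then show ?thesis
    by (simp add: nabla_J_def)
qed

theorem theorem3p24:
  fixes M :: "('a::{t2_space, second_countable_topology}, 'm::euclidean_space) atlas"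
    and B :: "('b::{t2_space, second_countable_topology}, 'n::real_normed_vector) atlas"
    and gM :: "'a metric_tensor" and gB :: "'b metric_tensor"
    and J :: "'a endo_field" and nab :: "'a connection"
    and F :: "'a \<Rightarrow> 'b" and D :: "'a \<Rightarrow> 'a tvec set" and H :: "'a vfield"
  assumes "nearly_kaehler_manifold M gM J nab"
    and "riemannian_manifold B gB"
    and "generic_riemannian_submersion M gM J B gB F D"
    and "totally_umbilical_fibers M gM nab B F H"
  shows "H \<in> sections M (\<lambda>p. omega M gM J B F p ` D_perp M gM B F D p)"
proof -
  have ah: "almost_hermitian_manifold M gM J" and lc: "levi_civita M gM nab"
    using assms(1) by (auto simp: nearly_kaehler_manifold_def)
  have rm: "riemannian_manifold M gM" and acs: "almost_complex_structure M J"
    and herm: "\<And>p u v. u \<in> tangent_space M p \<Longrightarrow> v \<in> tangent_space M p \<Longrightarrow>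
      gM p (J p u) (J p v) = gM p u v"
    using ah by (auto simp: almost_hermitian_manifold_def)
  have sm: "smooth_manifold M"
    using rm by (simp add: riemannian_manifold_def)
  have JT: "J p u \<in> tangent_space M p" and JJ: "J p (J p u) = - u"
    if "u \<in> tangent_space M p" for p u
    using acs that by (auto simp: almost_complex_structure_def)
  have Jlin: "J p (a *\<^sub>R u + b *\<^sub>R v) = a *\<^sub>R J p u + b *\<^sub>R J p v"
    if "u \<in> tangent_space M p" "v \<in> tangent_space M p" for p u v a b
    using acs that by (simp add: almost_complex_structure_def)
  interpret inner_product_on "tangent_space M q" "gM q" for q
    by (rule inner_product_on_tangent_space[OF rm])
  note ver = subspace_vertical[OF sm, of B F] vertical_subset[of M B F]
  note hor = subspace_horizontal[OF rm, of B F] horizontal_subset[of M gM B F]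
  \<comment> \<open>Apply \<open>J\<close>-invariance of the metric to \<open>J p u\<close> and
    \<open>v\<close>, then use \<open>J p (J p u) = - u\<close>.\<close>
  have J_skew: "gM p u (J p v) = - gM p (J p u) v"
    if "u \<in> tangent_space M p" "v \<in> tangent_space M p" for p u v
    using herm[of "J p u" p v] that by (simp add: JT JJ bilinear_left)
  obtain k where k: "k \<ge> 1" "smooth_distribution M k D"
    and D_ver: "\<And>p. D p \<subseteq> vertical M B F p"
    and split: "\<And>p. vertical M B F p = {u + v | u v. u \<in> D p \<and> v \<in> D_perp M gM B F D p}"
    and JD: "\<And>p. J p ` D p = D p"
    using assms(3) by (auto simp: generic_riemannian_submersion_def)
  have Hs: "H \<in> sections M (horizontal M gM B F)"
    using assms(4) by (simp add: totally_umbilical_fibers_def mean_curvature_field_def)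
  then have H_hor: "H p \<in> horizontal M gM B F p" for p
    by (simp add: sections_def)

  have H_orth: "gM p Y (H p) = 0"
    if Y: "Y \<in> horizontal M gM B F p" "J p Y \<in> horizontal M gM B F p" for p Y
  proof -
    obtain X where X: "X \<in> sections M D" "X p \<noteq> 0"
      using ex_nonzero_section[OF sm k(2,1)] by metis
    let ?JX = "\<lambda>q. J q (X q)"
    have Xv: "X \<in> vfields M" "?JX \<in> vfields M"
      using X(1) acs by (auto simp: sections_def almost_complex_structure_def)
    have XT: "X p \<in> tangent_space M p" "Y \<in> tangent_space M p" "nab X X p \<in> tangent_space M p"
      using Xv lc hor(2) Y(1) by (auto simp: smooth_vfield_on_def levi_civita_def)
    have "X q \<in> D q" for q
      using X(1) by (simp add: sections_def)
    then have "X q \<in> vertical M B F q" "J q (X q) \<in> vertical M B F q" for q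
      using D_ver JD by blast+
    then have Xs: "X \<in> sections M (vertical M B F)" "?JX \<in> sections M (vertical M B F)"
      using Xv by (simp_all add: sections_def)
    \<comment> \<open>Skewness of \<open>J\<close> and symmetry of the metric make this number its
      own negative.\<close>
    have "gM p (X p) (J p (X p)) = 0"
      using J_skew[OF XT(1,1)] sym[OF XT(1) JT[OF XT(1)]] by simp
    then have "gM p (J p Y) (nab X ?JX p) = 0"
      using inner_umbilical[OF rm lc assms(4) Xs Y(2)] by simp
    \<comment> \<open>Since \<open>nab X ?JX p\<close> equals \<open>J p (nab X X p)\<close>, both
      arguments carry a \<open>J\<close>, which the Hermitian metric cancels.\<close>
    then have "gM p Y (nab X X p) = 0"
      using herm[OF XT(2,3)] nearly_kaehler_nabla_J_self[OF assms(1) Xv(1), of p] by simp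
    then have "gM p (X p) (X p) * gM p Y (H p) = 0"
      using inner_umbilical[OF rm lc assms(4) Xs(1,1) Y(1)] by simp
    then show ?thesis
      using eq_0_iff[OF XT(1)] X(2) by simp
  qed

  have "H p \<in> omega M gM J B F p ` D_perp M gM B F D p" for p
  proof -
    let ?\<omega> = "omega M gM J B F p" and ?P = "D_perp M gM B F D p"
    have P_ver: "?P \<subseteq> vertical M B F p"
      by (auto simp: D_perp_def orth_in_def)
    have P_T: "?P \<subseteq> tangent_space M p" and D_T: "D p \<subseteq> tangent_space M p"
      using P_ver D_ver ver(2) by blast+
    have sP: "subspace ?P"
      unfolding D_perp_def orth_in_def by (rule subspace_orth[OF D_T ver(2,1)])
    have \<omega>_proj: "?\<omega> u = proj p (horizontal M gM B F p) (J p u)" for u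
      by (simp add: omega_def hor_proj_def orth_proj_eq_proj[OF rm])
    have \<omega>_lin: "?\<omega> (a *\<^sub>R u + b *\<^sub>R v) = a *\<^sub>R ?\<omega> u + b *\<^sub>R ?\<omega> v"
      if "u \<in> ?P" "v \<in> ?P" for a b u v
      unfolding \<omega>_proj using that P_T by (auto simp: Jlin JT subset_iff intro!: proj_linear[OF hor])
    have "?\<omega> u \<in> horizontal M gM B F p" if "u \<in> ?P" for u
      unfolding \<omega>_proj using that P_T by (auto intro!: proj(1)[OF hor] JT)
    then have \<omega>_hor: "?\<omega> ` ?P \<subseteq> horizontal M gM B F p"
      by blast
    \<comment> \<open>Needed for the orthogonal projection onto this image to be available.\<close>
    have s\<omega>: "subspace (?\<omega> ` ?P)"
      unfolding subspace_def
    proof (intro conjI ballI allI)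
      show "0 \<in> ?\<omega> ` ?P"
        using \<omega>_lin[of 0 0 0 0] subspace_0[OF sP] by (metis add_0 imageI scaleR_zero_left)
    next
      fix x y assume "x \<in> ?\<omega> ` ?P" "y \<in> ?\<omega> ` ?P"
      then obtain u v where "u \<in> ?P" "v \<in> ?P" "x = ?\<omega> u" "y = ?\<omega> v" by blast
      then show "x + y \<in> ?\<omega> ` ?P"
        using \<omega>_lin[of u v 1 1] subspace_add[OF sP] by (metis imageI scaleR_one)
    next
      fix c x assume "x \<in> ?\<omega> ` ?P"
      then obtain u where "u \<in> ?P" "x = ?\<omega> u" by blast
      then show "c *\<^sub>R x \<in> ?\<omega> ` ?P"
        using \<omega>_lin[of u u c 0] subspace_scale[OF sP] by (metis add_0_right imageI scaleR_zero_left)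
    qed
    have \<omega>_T: "?\<omega> ` ?P \<subseteq> tangent_space M p"
      using \<omega>_hor hor(2) by blast
    have H_T: "H p \<in> tangent_space M p"
      using H_hor hor(2) by blast
    \<comment> \<open>The remainder \<open>W = H p - h\<close> is the component of
      \<open>H p\<close> orthogonal to the image; the rest of the argument shows that it is
      zero.\<close>
    define h where "h = proj p (?\<omega> ` ?P) (H p)"
    have h: "h \<in> ?\<omega> ` ?P" "\<And>w. w \<in> ?\<omega> ` ?P \<Longrightarrow> gM p w h = gM p w (H p)"
      using proj[OF s\<omega> \<omega>_T H_T] by (auto simp: h_def)
    define W where "W = H p - h"
    have h_T: "h \<in> tangent_space M p"
      using h(1) \<omega>_T by blast
    have W_hor: "W \<in> horizontal M gM B F p"
      unfolding W_def using h(1) \<omega>_hor H_hor hor(1) by (blast intro: subspace_diff)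
    have W_T: "W \<in> tangent_space M p"
      using W_hor hor(2) by blast
    have W_\<omega>: "gM p w W = 0" if "w \<in> ?\<omega> ` ?P" for w
      using that h(2)[OF that] \<omega>_T H_T h_T by (auto simp: W_def bilinear_right subset_iff)
    have "J p W \<in> horizontal M gM B F p"
      unfolding horizontal_def orth_in_def
    proof (intro CollectI conjI ballI)
      fix u assume "u \<in> vertical M B F p"
      then obtain d e where de: "u = d + e" "d \<in> D p" "e \<in> ?P"
        using split by blast
      have T: "d \<in> tangent_space M p" "e \<in> tangent_space M p"
        using de P_T D_T by auto
      have "J p d \<in> vertical M B F p"
        using de(2) JD D_ver by blast
      then have "gM p (J p d) W = 0"
        using W_hor by (simp add: horizontal_def orth_in_def)
      \<comment> \<open>\<open>J p e\<close> and its horizontal part have the same inner product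
        with the horizontal vector \<open>W\<close>.\<close>
      moreover have "gM p (J p e) W = gM p (?\<omega> e) W"
        using proj(2)[OF hor JT[OF T(2)] W_hor] W_T JT[OF T(2)] \<omega>_T de(3)
        by (simp add: \<omega>_proj sym[of _ _ W] image_subset_iff)
      then have "gM p (J p e) W = 0"
        using W_\<omega> de(3) by simp
      ultimately show "gM p u (J p W) = 0"
        using T W_T Jlin[OF T, of 1 1] by (simp add: de(1) bilinear_left JT J_skew)
    qed (simp add: JT W_T)
    \<comment> \<open>Both \<open>W\<close> and \<open>J p W\<close> are horizontal, so
      \<open>H_orth\<close> applies. As \<open>W\<close> is also orthogonal to \<open>h\<close>, it
      is orthogonal to \<open>H p - h\<close>, that is, to itself.\<close>
    then have "gM p W (H p) = 0"
      using H_orth W_hor by blast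
    moreover have "gM p W h = 0"
      using W_\<omega>[OF h(1)] sym[OF W_T h_T] by simp
    ultimately have "gM p W W = 0"
      using W_T H_T h_T by (metis W_def bilinear_right(2) diff_zero)
    then have "W = 0"
      using eq_0_iff[OF W_T] by simp
    then show ?thesis
      using h(1) by (simp add: W_def)
  qed
  \<comment> \<open>Being a section means global smoothness, which \<open>H\<close> already has as a
    horizontal section, together with the pointwise membership just shown.\<close>
  then show ?thesis
    using Hs by (simp add: sections_def)
qed

end
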